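(* Let $\Gamma\rightarrow\Delta$ be a sequent with $\not\vdash_{\mathsf{NQGL}^-}\Gamma\rightarrow\Delta$. Then there exist a coinfinite subset $\mathcal{U}$ of $\mathcal{V}$ and a $\mathcal{U}$-saturated $\mathbf{GL}$-pair $(S,T)$ such that $\Gamma\subseteq S$ and $\Delta\subseteq T$.
   Context: Formulas are those of first-order modal logic over a countable set $\mathcal{V}$ of variables, with $\top,\bot$, predicate symbols of each finite arity (no function/constant symbols), $\land,\neg,\supset$, $\forall$, and $\Box$; $\Diamond=\neg\Box\neg$ and $\Diamond^n$ is $n$-fold $\Diamond$. $\mathsf{Var}(\phi)$ is the set of variables with a free or bound occurrence in $\phi$, and $\Phi(\mathcal{U})=\{\phi\mid\mathsf{Var}(\phi)\subseteq\mathcal{U}\}$. $\mathsf{NQGL}^-$ is the following sequent calculus (sequents $\Gamma\rightarrow\Delta$ are pairs of finite sets of formulas). Axioms: $p\rightarrow p$ ($p$ atomic), $\rightarrow\top$, $\bot\rightarrow$. Rules: weakening (from $\Gamma\rightarrow\Delta$ infer $\Gamma'\rightarrow\Delta'$ for $\Gamma\subseteq\Gamma'$, $\Delta\subseteq\Delta'$); standard LK rules for $\land$ (right: from $\Gamma\rightarrow\Delta,\phi$ and $\Gamma\rightarrow\Delta,\psi$ infer $\Gamma\rightarrow\Delta,\phi\land\psi$; left: from $\phi,\Gamma\rightarrow\Delta$ or $\psi,\Gamma\rightarrow\Delta$ infer $\phi\land\psi,\Gamma\rightarrow\Delta$), for $\supset$ (right: from $\phi,\Gamma\rightarrow\Delta,\psi$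 infer $\Gamma\rightarrow\Delta,\phi\supset\psi$; left: from $\Gamma\rightarrow\Delta,\phi$ and $\psi,\Lambda\rightarrow\Xi$ infer $\phi\supset\psi,\Gamma,\Lambda\rightarrow\Delta,\Xi$), for $\neg$ (from $\phi,\Gamma\rightarrow\Delta$ infer $\Gamma\rightarrow\Delta,\neg\phi$; from $\Gamma\rightarrow\Delta,\phi$ infer $\neg\phi,\Gamma\rightarrow\Delta$), for $\forall$ (from $\Gamma\rightarrow\Delta,\phi[y/x]$ infer $\Gamma\rightarrow\Delta,\forall x\phi$ with $y$ not occurring in the lower sequent; from $\phi[z/x],\Gamma\rightarrow\Delta$ infer $\forall x\phi,\Gamma\rightarrow\Delta$ for any $z$); (Box) from $\Box\Gamma,\Delta\rightarrow\phi$ infer $\Box\Gamma,\Box\Delta\rightarrow\Box\phi$ (where $\Box\Gamma=\{\Box\gamma\mid\gamma\in\Gamma\}$); and (Boundedness of length) from $\Gamma\rightarrow\Delta,\Diamond^n\top$ for all $n\in\mathbb{N}$ infer $\Gamma\rightarrow\Delta$. There is no cut rule. $\vdash_{\mathsf{NQGL}^-}$ denotes derivability (derivations may be infinitary). A pair $(S,T)$ of sets of formulas is finitely consistent if $\not\vdash_{\mathsf{NQGL}^-}S'\rightarrow T'$ for all finite $S'\subseteq S$, $T'\subseteq T$. It is a $\mathbf{GL}$-pair if it is finitely consistent and $\Box\neg\Diamond^n\top\in S$ for some $n\in\mathbb{N}$. For $\mathcal{U}\subseteq\mathcal{V}$, a finitely consistent pair $(S,T)$ of subsets of $\Phi(\mathcal{U})$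 is $\mathcal{U}$-saturated if: (1) $\phi_1\land\phi_2\in S$ implies $\phi_1,\phi_2\in S$, and $\phi_1\land\phi_2\in T$ implies $\phi_1\in T$ or $\phi_2\in T$; (2) $\phi_1\supset\phi_2\in S$ implies $\phi_1\in T$ or $\phi_2\in S$, and $\phi_1\supset\phi_2\in T$ implies $\phi_1\in S$ and $\phi_2\in T$; (3) $\neg\phi\in S$ implies $\phi\in T$, and $\neg\phi\in T$ implies $\phi\in S$; (4) $\forall x\phi\in S$ implies $\phi[z/x]\in S$ for all $z\in\mathcal{U}$, and $\forall x\phi\in T$ implies $\phi[z/x]\in T$ for some $z\in\mathcal{U}$. *)

theory Defs
  imports Main "HOL-Library.Countable_Set" "HOL-Combinatorics.Transposition"
begin

text \<open>
  A predicate symbol of arity \<open>n\<close> is a name of type \<open>'p\<close> applied to a list of length \<open>n\<close>; the same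
  name used with different lengths counts as different symbols. The generated function \<open>vars\<close>
  collects all variables with a free or bound occurrence; the variable in a quantifier prefix is
  included.
\<close>

datatype (preds: 'p, vars: 'v) fm =
    Verum
  | Falsum
  | Pred 'p "'v list"
  | Conj "('p, 'v) fm" "('p, 'v) fm"
  | Neg "('p, 'v) fm"
  | Imp "('p, 'v) fm" "('p, 'v) fm"
  | Forall 'v "('p, 'v) fm"
  | Box "('p, 'v) fm"
  for map: map_fm

definition Dia :: "('p, 'v) fm \<Rightarrow> ('p, 'v) fm" where
  "Dia \<phi> = Neg (Box (Neg \<phi>))"

primrec fv :: "('p, 'v) fm \<Rightarrow> 'v set" where
  "fv Verum = {}"
| "fv Falsum = {}"
| "fv (Pred p xs) = set xs"
| "fv (Conj \<phi> \<psi>) = fv \<phi> \<union> fv \<psi>"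
| "fv (Neg \<phi>) = fv \<phi>"
| "fv (Imp \<phi> \<psi>) = fv \<phi> \<union> fv \<psi>"
| "fv (Forall x \<phi>) = fv \<phi> - {x}"
| "fv (Box \<phi>) = fv \<phi>"

text \<open>
  \<open>inst x z \<phi>\<close> is the capture-avoiding substitution \<open>\<phi>[z/x]\<close>. A bound variable is renamed only
  where \<open>z\<close> would be captured, that is, in a subformula \<open>\<forall>z \<psi>\<close> with \<open>x\<close> free. There the new name of
  the bound variable is \<open>x\<close>, which is no longer free once it has been replaced by \<open>z\<close>. Replacing
  \<open>x\<close> by \<open>z\<close> and renaming the bound \<open>z\<close> to \<open>x\<close> simultaneously amounts to exchanging \<open>x\<close> and \<open>z\<close>
  throughout \<open>\<forall>z \<psi>\<close>; as \<open>z\<close> is not free there, the result is \<open>\<forall>z \<psi>\<close> with \<open>z\<close> substituted for \<open>x\<close>, up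
  to names of bound variables. No third variable is introduced, so instances of \<open>\<forall>x \<phi>\<close> by variables
  of \<open>U\<close> never leave the formulas over \<open>U\<close>.
\<close>

primrec inst :: "'v \<Rightarrow> 'v \<Rightarrow> ('p, 'v) fm \<Rightarrow> ('p, 'v) fm" where
  "inst x z Verum = Verum"
| "inst x z Falsum = Falsum"
| "inst x z (Pred p xs) = Pred p (map (id(x := z)) xs)"
| "inst x z (Conj \<phi> \<psi>) = Conj (inst x z \<phi>) (inst x z \<psi>)"
| "inst x z (Neg \<phi>) = Neg (inst x z \<phi>)"
| "inst x z (Imp \<phi> \<psi>) = Imp (inst x z \<phi>) (inst x z \<psi>)"
| "inst x z (Forall y \<phi>) =
    (if x \<notin> fv (Forall y \<phi>) then Forall y \<phi>
     else if y \<noteq> z then Forall y (inst x z \<phi>)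
     else Forall x (map_fm id (transpose x z) \<phi>))"
| "inst x z (Box \<phi>) = Box (inst x z \<phi>)"

lemma vars_inst: "vars (inst x z \<phi>) \<subseteq> insert x (insert z (vars \<phi>))"
  by (induction \<phi>) (auto simp: fm.set_map transpose_def split: if_splits)

lemma fv_map_fm: "inj f \<Longrightarrow> fv (map_fm g f \<phi>) = f ` fv \<phi>"
  by (induction \<phi>) (auto simp: inj_eq)

lemma fv_inst: "fv (inst x z \<phi>) = (if x \<in> fv \<phi> then insert z (fv \<phi> - {x}) else fv \<phi>)"
proof (induction \<phi>)
  case (Forall y \<phi>)
  have "fv (map_fm id (transpose x z) \<phi>) = transpose x z ` fv \<phi>"
    by (rule fv_map_fm) simp
  with Forall show ?case
    by (auto simp: transpose_def split: if_splits)
qed (auto split: if_splits)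

text \<open>
  Sequents are pairs of finite sets. Finiteness is imposed in weakening only; the other rules
  preserve it.
\<close>

inductive NQGLm :: "('p, 'v) fm set \<Rightarrow> ('p, 'v) fm set \<Rightarrow> bool" where
  Ax: "NQGLm {Pred p xs} {Pred p xs}"
| VerumR: "NQGLm {} {Verum}"
| FalsumL: "NQGLm {Falsum} {}"
| Weak: "NQGLm \<Gamma> \<Delta> \<Longrightarrow> \<Gamma> \<subseteq> \<Gamma>' \<Longrightarrow> \<Delta> \<subseteq> \<Delta>' \<Longrightarrow> finite \<Gamma>' \<Longrightarrow> finite \<Delta>' \<Longrightarrow> NQGLm \<Gamma>' \<Delta>'"
| ConjR: "NQGLm \<Gamma> (insert \<phi> \<Delta>) \<Longrightarrow> NQGLm \<Gamma> (insert \<psi> \<Delta>) \<Longrightarrow> NQGLm \<Gamma> (insert (Conj \<phi> \<psi>) \<Delta>)"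
| ConjL1: "NQGLm (insert \<phi> \<Gamma>) \<Delta> \<Longrightarrow> NQGLm (insert (Conj \<phi> \<psi>) \<Gamma>) \<Delta>"
| ConjL2: "NQGLm (insert \<psi> \<Gamma>) \<Delta> \<Longrightarrow> NQGLm (insert (Conj \<phi> \<psi>) \<Gamma>) \<Delta>"
| ImpR: "NQGLm (insert \<phi> \<Gamma>) (insert \<psi> \<Delta>) \<Longrightarrow> NQGLm \<Gamma> (insert (Imp \<phi> \<psi>) \<Delta>)"
| ImpL: "NQGLm \<Gamma> (insert \<phi> \<Delta>) \<Longrightarrow> NQGLm (insert \<psi> \<Lambda>) \<Xi> \<Longrightarrow>
    NQGLm (insert (Imp \<phi> \<psi>) (\<Gamma> \<union> \<Lambda>)) (\<Delta> \<union> \<Xi>)"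
| NegR: "NQGLm (insert \<phi> \<Gamma>) \<Delta> \<Longrightarrow> NQGLm \<Gamma> (insert (Neg \<phi>) \<Delta>)"
| NegL: "NQGLm \<Gamma> (insert \<phi> \<Delta>) \<Longrightarrow> NQGLm (insert (Neg \<phi>) \<Gamma>) \<Delta>"
| ForallR: "NQGLm \<Gamma> (insert (inst x y \<phi>) \<Delta>) \<Longrightarrow>
    y \<notin> \<Union> (vars ` (\<Gamma> \<union> insert (Forall x \<phi>) \<Delta>)) \<Longrightarrow> NQGLm \<Gamma> (insert (Forall x \<phi>) \<Delta>)"
| ForallL: "NQGLm (insert (inst x z \<phi>) \<Gamma>) \<Delta> \<Longrightarrow> NQGLm (insert (Forall x \<phi>) \<Gamma>) \<Delta>"
| BoxR: "NQGLm (Box ` \<Gamma> \<union> \<Delta>) {\<phi>} \<Longrightarrow> NQGLm (Box ` \<Gamma> \<union> Box ` \<Delta>) {Box \<phi>}"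
| BL: "(\<And>n. NQGLm \<Gamma> (insert ((Dia ^^ n) Verum) \<Delta>)) \<Longrightarrow> NQGLm \<Gamma> \<Delta>"

lemma NQGLm_finite: "NQGLm \<Gamma> \<Delta> \<Longrightarrow> finite \<Gamma> \<and> finite \<Delta>"
proof (induction rule: NQGLm.induct)
  case (BoxR \<Gamma> \<Delta> \<phi>)
  have "finite \<Gamma>"
    using BoxR.IH by (auto dest!: finite_imageD simp: inj_on_def)
  with BoxR.IH show ?case by simp
qed auto

definition finitely_consistent :: "('p, 'v) fm set \<Rightarrow> ('p, 'v) fm set \<Rightarrow> bool" where
  "finitely_consistent S T \<longleftrightarrow>
    (\<forall>S' T'. finite S' \<and> S' \<subseteq> S \<and> finite T' \<and> T' \<subseteq> T \<longrightarrow> \<not> NQGLm S' T')"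

definition GL_pair :: "('p, 'v) fm set \<Rightarrow> ('p, 'v) fm set \<Rightarrow> bool" where
  "GL_pair S T \<longleftrightarrow>
    finitely_consistent S T \<and> (\<exists>n. Box (Neg ((Dia ^^ n) Verum)) \<in> S)"

definition fms_over :: "'v set \<Rightarrow> ('p, 'v) fm set" where
  "fms_over U = {\<phi>. vars \<phi> \<subseteq> U}"

definition saturated :: "'v set \<Rightarrow> ('p, 'v) fm set \<Rightarrow> ('p, 'v) fm set \<Rightarrow> bool" where
  "saturated U S T \<longleftrightarrow>
    finitely_consistent S T \<and> S \<subseteq> fms_over U \<and> T \<subseteq> fms_over U \<and>
    (\<forall>\<phi> \<psi>. Conj \<phi> \<psi> \<in> S \<longrightarrow> \<phi> \<in> S \<and> \<psi> \<in> S) \<and>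
    (\<forall>\<phi> \<psi>. Conj \<phi> \<psi> \<in> T \<longrightarrow> \<phi> \<in> T \<or> \<psi> \<in> T) \<and>
    (\<forall>\<phi> \<psi>. Imp \<phi> \<psi> \<in> S \<longrightarrow> \<phi> \<in> T \<or> \<psi> \<in> S) \<and>
    (\<forall>\<phi> \<psi>. Imp \<phi> \<psi> \<in> T \<longrightarrow> \<phi> \<in> S \<and> \<psi> \<in> T) \<and>
    (\<forall>\<phi>. Neg \<phi> \<in> S \<longrightarrow> \<phi> \<in> T) \<and>
    (\<forall>\<phi>. Neg \<phi> \<in> T \<longrightarrow> \<phi> \<in> S) \<and>
    (\<forall>x \<phi>. Forall x \<phi> \<in> S \<longrightarrow> (\<forall>z \<in> U. inst x z \<phi> \<in> S)) \<and>
    (\<forall>x \<phi>. Forall x \<phi> \<in> T \<longrightarrow> (\<exists>z \<in> U. inst x z \<phi> \<in> T))"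

end

theory Submission
  imports Defs
begin

text \<open>
  Boundedness of length yields \<open>n\<close> such that \<open>\<Gamma> \<rightarrow> \<Delta>, \<diamond>\<^sup>n\<top>\<close> is underivable; \<open>n > 0\<close> because of the
  axiom for \<open>\<top>\<close>. As \<open>\<diamond>\<^sup>n\<top>\<close> is a negation, the rule for \<open>\<not>\<close> on the right, read backwards, moves
  \<open>\<box>\<not>\<diamond>\<^sup>n\<^sup>-\<^sup>1\<top>\<close> to the left, so neither cut nor invertibility is needed. The sequent is then saturated
  through finite underivable sequents, treating each saturation requirement infinitely often. All
  stages being finite, the infinite set \<open>U\<close> always contains a fresh witness.
\<close>

section \<open>Fair enumeration of saturation requirements\<close>

text \<open>Bookkeeping kept apart from the logic: \<open>I\<close> is the invariant of the stages,
  and \<open>E k a\<close> collects the admissible ways of meeting requirement \<open>k\<close> on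
  \<open>a\<close>. The limit \<open>Y\<close> need not satisfy \<open>I\<close>; that its finite
  parts lie in stages is enough for finite consistency.\<close>

lemma fair_saturation:
  fixes I :: "'a set \<Rightarrow> bool" and E :: "'k \<Rightarrow> 'a \<Rightarrow> 'a set set"
  assumes "countable K" and "countable A"
    and sub: "\<And>X. I X \<Longrightarrow> X \<subseteq> A"
    and step: "\<And>X k a. I X \<Longrightarrow> k \<in> K \<Longrightarrow> a \<in> X \<Longrightarrow> \<exists>B \<in> E k a. I (X \<union> B)"
    and "I X0"
  obtains Y where "X0 \<subseteq> Y" and "Y \<subseteq> A"
    and "\<And>F. finite F \<Longrightarrow> F \<subseteq> Y \<Longrightarrow> \<exists>X. I X \<and> F \<subseteq> X"
    and "\<And>k a. k \<in> K \<Longrightarrow> a \<in> Y \<Longrightarrow> \<exists>B \<in> E k a. B \<subseteq> Y"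
proof -
  \<comment> \<open>The second component of \<open>prod_decode n\<close> is ignored, so every pair
    recurs infinitely often. The guards in \<open>sat\<close> cover elements not yet present and the
    arbitrary value of \<open>from_nat_into\<close> on an empty set.\<close>
  define req where "req n = from_nat_into (K \<times> A) (fst (prod_decode n))" for n
  define sat where "sat n X X' \<longleftrightarrow>
      (\<forall>k a. req n = (k, a) \<longrightarrow> k \<in> K \<longrightarrow> a \<in> X \<longrightarrow> (\<exists>B \<in> E k a. B \<subseteq> X'))" for n X X'
  have "\<exists>X'. I X' \<and> X \<subseteq> X' \<and> sat n X X'" if "I X" for X n
  proof -
    obtain k a where ka: "req n = (k, a)"
      by fastforce
    show ?thesis
    proof (cases "k \<in> K \<and> a \<in> X")
      case True
      with step[OF that] obtain B where B: "B \<in> E k a" "I (X \<union> B)"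
        by blast
      then have "sat n X (X \<union> B)"
        unfolding sat_def ka by blast
      with B(2) show ?thesis
        by blast
    next
      case False
      then have "sat n X X"
        unfolding sat_def ka by blast
      with that show ?thesis
        by blast
    qed
  qed
  then have "\<exists>f. \<forall>n. (I (f n) \<and> (n = 0 \<longrightarrow> f n = X0)) \<and> f n \<subseteq> f (Suc n) \<and> sat n (f n) (f (Suc n))"
    using \<open>I X0\<close> by (intro dependent_nat_choice) simp_all
  then obtain f where f0: "f 0 = X0" and I: "\<And>n. I (f n)" and mono_Suc: "\<And>n. f n \<subseteq> f (Suc n)"
    and met: "\<And>n. sat n (f n) (f (Suc n))"
    by auto
  have mono: "f m \<subseteq> f n" if "m \<le> n" for m n
    using lift_Suc_mono_le[of f, OF mono_Suc that] .
  show thesis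
  proof
    show "X0 \<subseteq> \<Union> (range f)"
      using f0 by blast
    show "\<Union> (range f) \<subseteq> A"
      using sub I by blast
  next
    fix F assume "finite F" and "F \<subseteq> \<Union> (range f)"
    then have "\<exists>n. F \<subseteq> f n"
    proof (induction F)
      case (insert a F)
      then obtain m n where "a \<in> f m" "F \<subseteq> f n"
        by blast
      then have "insert a F \<subseteq> f (max m n)"
        using mono[of m "max m n"] mono[of n "max m n"] by auto
      then show ?case ..
    qed simp
    then show "\<exists>X. I X \<and> F \<subseteq> X"
      using I by blast
  next
    fix k a assume k: "k \<in> K" and "a \<in> \<Union> (range f)"
    then obtain m where m: "a \<in> f m"
      by blast
    with sub I have "a \<in> A"
      by blast
    with k \<open>countable K\<close> \<open>countable A\<close> obtain i where i: "from_nat_into (K \<times> A) i = (k, a)"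
      using from_nat_into_surj[of "K \<times> A" "(k, a)"] by auto
    \<comment> \<open>This stage treats request \<open>i\<close> and is not earlier than
      \<open>m\<close>, so \<open>a\<close> is already present.\<close>
    let ?n = "prod_encode (i, m)"
    have "a \<in> f ?n"
      using m mono[OF le_prod_encode_2] by blast
    with met[of ?n] k i obtain B where "B \<in> E k a" "B \<subseteq> f (Suc ?n)"
      by (auto simp: req_def sat_def)
    then show "\<exists>B \<in> E k a. B \<subseteq> \<Union> (range f)"
      by blast
  qed
qed

section \<open>Countability and finiteness facts about formulas\<close>

instance fm :: (countable, countable) countable
  by countable_datatype

text \<open>Numbering \<open>P\<close> and \<open>U\<close> maps these formulas injectively to
  formulas over natural numbers, of which there are countably many; the types themselves may be
  uncountable.\<close>

lemma countable_fms:
  assumes "countable P" and "countable U"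
  shows "countable {\<phi> :: ('p, 'v) fm. preds \<phi> \<subseteq> P \<and> vars \<phi> \<subseteq> U}"
proof -
  let ?m = "map_fm (to_nat_on P) (to_nat_on U)"
  have "inj_on ?m {\<phi> :: ('p, 'v) fm. preds \<phi> \<subseteq> P \<and> vars \<phi> \<subseteq> U}"
  proof (rule inj_onI)
    fix \<phi> \<psi> :: "('p, 'v) fm"
    assume "\<phi> \<in> {\<phi>. preds \<phi> \<subseteq> P \<and> vars \<phi> \<subseteq> U}" "\<psi> \<in> {\<phi>. preds \<phi> \<subseteq> P \<and> vars \<phi> \<subseteq> U}"
      and eq: "?m \<phi> = ?m \<psi>"
    then have sub: "preds \<phi> \<subseteq> P" "vars \<phi> \<subseteq> U" "preds \<psi> \<subseteq> P" "vars \<psi> \<subseteq> U"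
      by simp_all
    show "\<phi> = \<psi>"
    proof (rule fm.inj_map_strong[OF _ _ eq])
      show "p = q" if "p \<in> preds \<phi>" "q \<in> preds \<psi>" "to_nat_on P p = to_nat_on P q" for p q
        using inj_onD[OF inj_on_to_nat_on[OF assms(1)] that(3)] that(1,2) sub by blast
      show "x = y" if "x \<in> vars \<phi>" "y \<in> vars \<psi>" "to_nat_on U x = to_nat_on U y" for x y
        using inj_onD[OF inj_on_to_nat_on[OF assms(2)] that(3)] that(1,2) sub by blast
    qed
  qed
  then show ?thesis
    using countable_image_inj_on countableI_type by blast
qed

lemma preds_inst [simp]: "preds (inst x z \<phi>) = preds \<phi>"
  by (induction \<phi>) (auto simp: fm.set_map)

lemma finite_vars [simp]: "finite (vars \<phi>)"
  by (induction \<phi>) auto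

lemma finite_preds [simp]: "finite (preds \<phi>)"
  by (induction \<phi>) auto

lemma vars_Dia_power_Verum [simp]: "vars ((Dia ^^ n) Verum) = {}"
  by (induction n) (auto simp: Dia_def)

lemma preds_Dia_power_Verum [simp]: "preds ((Dia ^^ n) Verum) = {}"
  by (induction n) (auto simp: Dia_def)

section \<open>Starting data: the length bound and the set of variables\<close>

lemma underivable_imp_length_bound:
  assumes "\<not> NQGLm \<Gamma> \<Delta>" and "finite \<Gamma>" and "finite \<Delta>"
  obtains n where "\<not> NQGLm (insert (Box (Neg ((Dia ^^ n) Verum))) \<Gamma>) \<Delta>"
proof -
  obtain m where m: "\<not> NQGLm \<Gamma> (insert ((Dia ^^ m) Verum) \<Delta>)"
    using BL assms(1) by blast
  have "NQGLm \<Gamma> (insert Verum \<Delta>)"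
    by (rule Weak[OF VerumR]) (use assms(2,3) in auto)
  with m obtain n where "m = Suc n"
    by (cases m) auto
  with m have "\<not> NQGLm \<Gamma> (insert (Neg (Box (Neg ((Dia ^^ n) Verum)))) \<Delta>)"
    by (simp add: Dia_def)
  then show thesis
    using that NegR by blast
qed

text \<open>The even terms of an injective sequence make \<open>U\<close> infinite; the odd terms
  stay outside, except for finitely many in \<open>W\<close>.\<close>

lemma infinite_coinfinite_superset:
  assumes "infinite (UNIV :: 'a set)" and "finite W"
  obtains U :: "'a set" where "W \<subseteq> U" "infinite U" "infinite (- U)"
proof -
  obtain f :: "nat \<Rightarrow> 'a" where f: "inj f"
    using infinite_countable_subset[OF assms(1)] by blast
  let ?U = "W \<union> range (\<lambda>n. f (2 * n))"
  have "infinite (range (\<lambda>n. f (2 * n)))" "infinite (range (\<lambda>n. f (2 * n + 1)))"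
    by (intro range_inj_infinite injI; use injD[OF f] in fastforce)+
  moreover have "f (2 * m + 1) \<noteq> f (2 * n)" for m n
    by (metis f injD even_add even_mult_iff even_numeral odd_one)
  then have "range (\<lambda>n. f (2 * n + 1)) - W \<subseteq> - ?U"
    by auto
  ultimately show thesis
    using that[of ?U] assms(2) by (meson Diff_infinite_finite finite_Un infinite_super sup_ge1)
qed

section \<open>Signed sequents and their expansions\<close>

text \<open>The truth value \<open>True\<close> marks formulas on the left of a sequent, \<open>False\<close> those on the right.\<close>

type_synonym ('p, 'v) signed = "bool \<times> ('p, 'v) fm"

definition side :: "bool \<Rightarrow> ('p, 'v) signed set \<Rightarrow> ('p, 'v) fm set" where
  "side s X = {\<phi>. (s, \<phi>) \<in> X}"

lemma mem_side [simp]: "\<phi> \<in> side s X \<longleftrightarrow> (s, \<phi>) \<in> X"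
  by (simp add: side_def)

lemma side_insert [simp]: "side s (insert (t, \<phi>) X) = (if s = t then insert \<phi> (side s X) else side s X)"
  by (auto simp: side_def)

lemma finite_side: "finite X \<Longrightarrow> finite (side s X)"
  by (rule finite_subset[of _ "snd ` X"]) force+

text \<open>
  A signed formula in a saturated set requires one of its expansions to be included. The variable
  \<open>z\<close> is used for instances of universal formulas on the left only, each \<open>z\<close> giving a separate
  requirement.
\<close>

fun expansions :: "'v set \<Rightarrow> 'v \<Rightarrow> ('p, 'v) signed \<Rightarrow> ('p, 'v) signed set set" where
  "expansions U z (True, Conj \<phi> \<psi>) = {{(True, \<phi>), (True, \<psi>)}}"
| "expansions U z (False, Conj \<phi> \<psi>) = {{(False, \<phi>)}, {(False, \<psi>)}}"
| "expansions U z (True, Imp \<phi> \<psi>) = {{(False, \<phi>)}, {(True, \<psi>)}}"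
| "expansions U z (False, Imp \<phi> \<psi>) = {{(True, \<phi>), (False, \<psi>)}}"
| "expansions U z (s, Neg \<phi>) = {{(\<not> s, \<phi>)}}"
| "expansions U z (True, Forall x \<phi>) = {{(True, inst x z \<phi>)}}"
| "expansions U z (False, Forall x \<phi>) = (\<lambda>y. {(False, inst x y \<phi>)}) ` U"
| "expansions U z (s, \<phi>) = {{}}"

text \<open>Keeps the stages inside one countable set. The universal cases rely on
  \<open>inst x z\<close> introducing no variable beyond \<open>x\<close> and \<open>z\<close>;
  \<open>vars\<close> of the quantified formula already contains \<open>x\<close>.\<close>

lemma expansions_closed:
  assumes "B \<in> expansions U z a" and "z \<in> U"
    and "a \<in> UNIV \<times> {\<phi>. preds \<phi> \<subseteq> P \<and> vars \<phi> \<subseteq> U}"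
  shows "B \<subseteq> UNIV \<times> {\<phi>. preds \<phi> \<subseteq> P \<and> vars \<phi> \<subseteq> U}"
proof -
  obtain s \<phi> where "a = (s, \<phi>)"
    by fastforce
  with assms show ?thesis
    by (cases s; cases \<phi>) (auto dest!: vars_inst[THEN subsetD])
qed

lemma finite_expansions: "B \<in> expansions U z a \<Longrightarrow> finite B"
  by (induction U z a rule: expansions.induct) auto

text \<open>By contraposition: if every expansion were derivable, the matching rules would derive
  the sequent itself, since the principal formula already lies in \<open>X\<close> and is
  absorbed.\<close>

lemma expansions_underivable:
  assumes "\<not> NQGLm (side True X) (side False X)" and "a \<in> X" and "finite X" and "infinite U"
  shows "\<exists>B \<in> expansions U z a. \<not> NQGLm (side True (X \<union> B)) (side False (X \<union> B))"
  using assms(1,2,4)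
proof (induction U z a rule: expansions.induct)
  case (1 U z \<phi> \<psi>)
  \<comment> \<open>The expansion adds both conjuncts, so the two left rules are applied in
    succession, the first with \<open>\<psi>\<close> kept in the context.\<close>
  then show ?case
    using ConjL1[of \<phi> "insert \<psi> (side True X)" "side False X" \<psi>]
      ConjL2[of \<psi> "side True X" "side False X" \<phi>]
    by (auto simp: insert_absorb)
next
  case (2 U z \<phi> \<psi>)
  then show ?case
    using ConjR[of "side True X" \<phi> "side False X" \<psi>] by (auto simp: insert_absorb)
next
  case (3 U z \<phi> \<psi>)
  \<comment> \<open>Both premises get the same context, so the unions in the conclusion
    collapse.\<close>
  then show ?case
    using ImpL[of "side True X" \<phi> "side False X" \<psi> "side True X" "side False X"]
    by (auto simp: insert_absorb)
next
  case (4 U z \<phi> \<psi>)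
  then show ?case
    using ImpR[of \<phi> "side True X" \<psi> "side False X"] by (auto simp: insert_absorb)
next
  case (5 U z s \<phi>)
  then show ?case
    using NegL[of "side True X" \<phi> "side False X"] NegR[of \<phi> "side True X" "side False X"]
    by (cases s) (auto simp: insert_absorb)
next
  case (6 U z x \<phi>)
  then show ?case
    using ForallL[of x z \<phi> "side True X" "side False X"] by (auto simp: insert_absorb)
next
  case (7 U z x \<phi>)
  \<comment> \<open>The eigenvariable must avoid bound occurrences too; this still excludes only
    finitely many elements of \<open>U\<close>.\<close>
  have "finite (\<Union> (vars ` (side True X \<union> side False X)))"
    using finite_side[OF assms(3)] by auto
  with \<open>infinite U\<close> obtain y where "y \<in> U" "y \<notin> \<Union> (vars ` (side True X \<union> side False X))"
    by (meson finite_subset subsetI)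
  then have "\<not> NQGLm (side True X) (insert (inst x y \<phi>) (side False X))"
    using ForallR[of "side True X" x y \<phi> "side False X"] 7(1,2) by (auto simp: insert_absorb)
  with \<open>y \<in> U\<close> show ?case
    by (intro bexI[of _ "{(False, inst x y \<phi>)}"]) auto
qed simp_all

section \<open>Construction of the saturated pair\<close>

theorem theorem8:
  fixes \<Gamma> \<Delta> :: "('p, 'v) fm set"
  assumes "countable (UNIV :: 'v set)" and "infinite (UNIV :: 'v set)"
    and "finite \<Gamma>" and "finite \<Delta>"
    and "\<not> NQGLm \<Gamma> \<Delta>"
  shows "\<exists>(U :: 'v set) S T. infinite (- U) \<and> saturated U S T \<and> GL_pair S T \<and> \<Gamma> \<subseteq> S \<and> \<Delta> \<subseteq> T"
proof -
  \<comment> \<open>Fixing the predicate symbols keeps the set of requirements countable even if \<open>'p\<close> is not.\<close>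
  define P where "P = \<Union> (preds ` (\<Gamma> \<union> \<Delta>))"
  obtain U where "\<Union> (vars ` (\<Gamma> \<union> \<Delta>)) \<subseteq> U" and U: "infinite U" "infinite (- U)"
    using infinite_coinfinite_superset[OF assms(2), of "\<Union> (vars ` (\<Gamma> \<union> \<Delta>))"] assms(3,4) by auto
  obtain n where n: "\<not> NQGLm (insert (Box (Neg ((Dia ^^ n) Verum))) \<Gamma>) \<Delta>"
    by (rule underivable_imp_length_bound[OF assms(5,3,4)])
  define A :: "('p, 'v) signed set"
    where "A = UNIV \<times> {\<phi>. preds \<phi> \<subseteq> P \<and> vars \<phi> \<subseteq> U}"
  define I where "I X \<longleftrightarrow> finite X \<and> X \<subseteq> A \<and> \<not> NQGLm (side True X) (side False X)"
    for X :: "('p, 'v) signed set"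
  define X0 where
    "X0 = Pair True ` insert (Box (Neg ((Dia ^^ n) Verum))) \<Gamma> \<union> Pair False ` \<Delta>"
  have countable_U: "countable U"
    by (rule countable_subset[OF subset_UNIV assms(1)])
  have "countable P"
    unfolding P_def using assms(3,4) by (intro countable_finite) auto
  then have "countable A"
    unfolding A_def using countable_U by (intro countable_SIGMA countable_fms) auto
  moreover have "X0 \<subseteq> A"
    unfolding X0_def A_def P_def using \<open>\<Union> (vars ` (\<Gamma> \<union> \<Delta>)) \<subseteq> U\<close> by auto
  moreover have "side True X0 = insert (Box (Neg ((Dia ^^ n) Verum))) \<Gamma>" "side False X0 = \<Delta>"
    by (auto simp: X0_def)
  ultimately have "I X0"
    unfolding I_def using n assms(3,4) by (simp add: X0_def)
  have step: "\<exists>B \<in> expansions U z a. I (X \<union> B)" if IX: "I X" and z: "z \<in> U" and a: "a \<in> X" for X z a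
  proof -
    obtain B where B: "B \<in> expansions U z a"
      "\<not> NQGLm (side True (X \<union> B)) (side False (X \<union> B))"
      using expansions_underivable[of X a U z] IX a U(1) by (auto simp: I_def)
    moreover have "B \<subseteq> A"
      using expansions_closed[OF B(1) z, of P] IX a unfolding I_def A_def by blast
    ultimately show ?thesis
      using finite_expansions[OF B(1)] IX by (auto simp: I_def)
  qed
  \<comment> \<open>Requirements are indexed by \<open>U\<close> itself, so that left universal
    formulas are instantiated with every \<open>z\<close> in \<open>U\<close>.\<close>
  obtain Y where "X0 \<subseteq> Y" and "Y \<subseteq> A"
    and fin: "\<And>F. finite F \<Longrightarrow> F \<subseteq> Y \<Longrightarrow> \<exists>X. I X \<and> F \<subseteq> X"
    and exp: "\<And>z a. z \<in> U \<Longrightarrow> a \<in> Y \<Longrightarrow> \<exists>B \<in> expansions U z a. B \<subseteq> Y"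
    using fair_saturation[OF countable_U \<open>countable A\<close>, of I "expansions U" X0] step \<open>I X0\<close>
    by (auto simp: I_def)
  \<comment> \<open>Requirements other than those of left universal formulas do not depend on the
    index, but some index is needed to invoke them.\<close>
  obtain u where "u \<in> U"
    using U(1) by fastforce
  note expu = exp[OF \<open>u \<in> U\<close>]
  have consistent: "finitely_consistent (side True Y) (side False Y)"
    unfolding finitely_consistent_def
  proof (intro allI impI notI)
    fix S T
    assume ST: "finite S \<and> S \<subseteq> side True Y \<and> finite T \<and> T \<subseteq> side False Y" and "NQGLm S T"
    then have "Pair True ` S \<union> Pair False ` T \<subseteq> Y"
      by (auto simp: subset_iff)
    with ST obtain X where X: "I X" "Pair True ` S \<union> Pair False ` T \<subseteq> X"
      using fin[of "Pair True ` S \<union> Pair False ` T"] by blast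
    \<comment> \<open>A derivation from finite parts of the limit would weaken to one of the whole
      stage \<open>X\<close>.\<close>
    then have "NQGLm (side True X) (side False X)"
      by (intro Weak[OF \<open>NQGLm S T\<close>] finite_side) (auto simp: I_def)
    with X show False
      by (simp add: I_def)
  qed
  have "saturated U (side True Y) (side False Y)"
    unfolding saturated_def
  proof (intro conjI allI impI ballI)
    show "side True Y \<subseteq> fms_over U" "side False Y \<subseteq> fms_over U"
      using \<open>Y \<subseteq> A\<close> by (auto simp: A_def fms_over_def)
  next
    fix x \<phi> z assume "Forall x \<phi> \<in> side True Y" "z \<in> U"
    then show "inst x z \<phi> \<in> side True Y"
      using exp[of z "(True, Forall x \<phi>)"] by simp
  next
    fix \<phi> \<psi> assume "Conj \<phi> \<psi> \<in> side False Y"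
    then show "\<phi> \<in> side False Y \<or> \<psi> \<in> side False Y"
      using expu[of "(False, Conj \<phi> \<psi>)"] by simp
  next
    fix \<phi> \<psi> assume "Imp \<phi> \<psi> \<in> side True Y"
    then show "\<phi> \<in> side False Y \<or> \<psi> \<in> side True Y"
      using expu[of "(True, Imp \<phi> \<psi>)"] by simp
  next
    fix x \<phi> assume "Forall x \<phi> \<in> side False Y"
    then show "\<exists>z \<in> U. inst x z \<phi> \<in> side False Y"
      using expu[of "(False, Forall x \<phi>)"] by auto
  qed (use consistent in \<open>auto dest: expu\<close>)
  moreover have "GL_pair (side True Y) (side False Y)"
    unfolding GL_pair_def using consistent \<open>X0 \<subseteq> Y\<close> by (auto simp: X0_def)
  moreover have "\<Gamma> \<subseteq> side True Y" "\<Delta> \<subseteq> side False Y"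
    using \<open>X0 \<subseteq> Y\<close> by (auto simp: X0_def)
  ultimately show ?thesis
    using U(2) by blast
qed

end
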